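(* Let $G$ be a finite weighted directed acyclic graph (each vertex $v$ carries a real weight $w(v)$). If $G$ has a non-negative mark-unmark sequence, then $G$ also has a non-negative mark sequence.
   Context: A set $M$ of vertices of a DAG $G$ is inward closed if for every edge $uv\in E(G)$, $v\in M$ implies $u\in M$. For a set $X$ of vertices, $w(X)=\sum_{x\in X}w(x)$. A mark sequence of $G$ (with $n$ vertices) is a sequence $M_1,\dots,M_n$ of subsets of $V(G)$ where $M_1=\{v\}$ for some source $v$, and for $i=2,\dots,n$, $M_i=M_{i-1}\cup\{u\}$ for some $u\notin M_{i-1}$ such that $M_{i-1}\cup\{u\}$ is inward closed ("marking" $u$). A mark-unmark sequence of $G$ is a sequence $M_1,M_2,\dots,M_t$ of subsets of $V(G)$ where $M_1=\{v\}$ for some source $v$, and for each $i\ge 2$ either $M_i=M_{i-1}\cup\{u\}$ for some $u\notin M_{i-1}$ with $M_{i-1}\cup\{u\}$ inward closed (marking $u$), or $M_i=M_{i-1}\setminus\{u\}$ for some $u\in M_{i-1}$ with $M_{i-1}\setminus\{u\}$ inward closed (unmarking $u$); the sequence stops at the first $t$ with $M_t=V(G)$. A mark or mark-unmark sequence is non-negative if $w(M_i)\ge 0$ for every $i$. *)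

theory Defs
  imports Complex_Main "Graph_Theory.Arc_Walk"
begin

locale dag = fin_digraph +
  assumes no_cycle: "\<not> (\<exists>c. cycle c)"

definition source :: "('a, 'b) pre_digraph \<Rightarrow> 'a \<Rightarrow> bool" where
  "source G v \<longleftrightarrow> v \<in> verts G \<and> in_arcs G v = {}"

definition inward_closed :: "('a, 'b) pre_digraph \<Rightarrow> 'a set \<Rightarrow> bool" where
  "inward_closed G M \<longleftrightarrow>
     M \<subseteq> verts G \<and> (\<forall>u v. u \<rightarrow>\<^bsub>G\<^esub> v \<longrightarrow> v \<in> M \<longrightarrow> u \<in> M)"

definition marking :: "('a, 'b) pre_digraph \<Rightarrow> 'a set \<Rightarrow> 'a set \<Rightarrow> bool" where
  "marking G M M' \<longleftrightarrow> (\<exists>u. u \<notin> M \<and> M' = M \<union> {u} \<and> inward_closed G (M \<union> {u}))"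

definition unmarking :: "('a, 'b) pre_digraph \<Rightarrow> 'a set \<Rightarrow> 'a set \<Rightarrow> bool" where
  "unmarking G M M' \<longleftrightarrow> (\<exists>u. u \<in> M \<and> M' = M - {u} \<and> inward_closed G (M - {u}))"

text \<open>Sequences are lists, so \<open>M\<^sub>i\<close> is \<open>Ms ! (i - 1)\<close>.\<close>

definition mark_sequence :: "('a, 'b) pre_digraph \<Rightarrow> 'a set list \<Rightarrow> bool" where
  "mark_sequence G Ms \<longleftrightarrow>
     Ms \<noteq> [] \<and> length Ms = card (verts G) \<and>
     (\<exists>v. source G v \<and> Ms ! 0 = {v}) \<and>
     (\<forall>i. Suc i < length Ms \<longrightarrow> marking G (Ms ! i) (Ms ! Suc i))"

text \<open>The last two conjuncts say that the sequence stops at the first occurrence of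
  \<open>verts G\<close>. The empty set may occur in the sequence.\<close>

definition mark_unmark_sequence :: "('a, 'b) pre_digraph \<Rightarrow> 'a set list \<Rightarrow> bool" where
  "mark_unmark_sequence G Ms \<longleftrightarrow>
     Ms \<noteq> [] \<and>
     (\<exists>v. source G v \<and> Ms ! 0 = {v}) \<and>
     (\<forall>i. Suc i < length Ms \<longrightarrow>
        marking G (Ms ! i) (Ms ! Suc i) \<or> unmarking G (Ms ! i) (Ms ! Suc i)) \<and>
     last Ms = verts G \<and>
     (\<forall>i. Suc i < length Ms \<longrightarrow> Ms ! i \<noteq> verts G)"

definition nonneg_sequence :: "('a \<Rightarrow> real) \<Rightarrow> 'a set list \<Rightarrow> bool" where
  "nonneg_sequence w Ms \<longleftrightarrow> (\<forall>M \<in> set Ms. sum w M \<ge> 0)"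

end

theory Submission
  imports Defs
begin

text \<open>
  Call a set reachable if it is obtained from the empty set by non-negative markings.
  Along the given mark-unmark sequence, each member is contained in a reachable set \<open>X\<close>.
  This is trivial when a vertex is unmarked. When \<open>u\<close> is added to \<open>M\<close>, pick an inward closed set
  \<open>C\<close> of maximum weight with \<open>M \<subseteq> C \<subseteq> X\<close>. As \<open>w\<close> is modular,
  \<open>w (P \<inter> C) = w P + w C - w (P \<union> C) \<ge> w P\<close> for every \<open>P\<close> on the way to \<open>X\<close>,
  so intersecting with \<open>C\<close> shows that \<open>C\<close> is reachable; and \<open>C \<union> {u}\<close> weighs at least as much as
  \<open>M \<union> {u}\<close>.
\<close>

text \<open>Starting from the empty set rather than from a source lets intersections
  \<open>P \<inter> C\<close> be empty without a special case.\<close>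

inductive mark_reachable :: "('a, 'b) pre_digraph \<Rightarrow> ('a \<Rightarrow> real) \<Rightarrow> 'a set \<Rightarrow> bool"
  for G w where
  empty: "mark_reachable G w {}"
| insert: "mark_reachable G w X \<Longrightarrow> u \<notin> X \<Longrightarrow> inward_closed G (insert u X) \<Longrightarrow>
    sum w (insert u X) \<ge> 0 \<Longrightarrow> mark_reachable G w (insert u X)"

lemma inward_closed_Un:
  "inward_closed G A \<Longrightarrow> inward_closed G B \<Longrightarrow> inward_closed G (A \<union> B)"
  unfolding inward_closed_def by blast

lemma inward_closed_Int:
  "inward_closed G A \<Longrightarrow> inward_closed G B \<Longrightarrow> inward_closed G (A \<inter> B)"
  unfolding inward_closed_def by blast

lemma (in fin_digraph) inward_closed_finite: "inward_closed G A \<Longrightarrow> finite A"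
  unfolding inward_closed_def using finite_subset finite_verts by blast

lemma mark_reachable_inward_closed: "mark_reachable G w X \<Longrightarrow> inward_closed G X"
  by (erule mark_reachable.cases) (auto simp: inward_closed_def)

text \<open>Maximality of \<open>C\<close> is demanded only up to \<open>C \<union> P\<close>, a
  bound that passes to every smaller \<open>P\<close> in the induction. A marking of
  \<open>u\<close> outside \<open>C\<close> leaves the intersection unchanged; a marking inside
  \<open>C\<close> survives by modularity.\<close>

lemma (in fin_digraph) mark_reachable_Int:
  assumes "mark_reachable G w P" "inward_closed G C"
    and "\<And>Z. inward_closed G Z \<Longrightarrow> C \<subseteq> Z \<Longrightarrow> Z \<subseteq> C \<union> P \<Longrightarrow> sum w Z \<le> sum w C"
  shows "mark_reachable G w (P \<inter> C)"
  using assms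
proof (induction rule: mark_reachable.induct)
  case empty
  then show ?case by (simp add: mark_reachable.empty)
next
  case (insert P u)
  have IH: "mark_reachable G w (P \<inter> C)"
    using insert.prems by (intro insert.IH) auto
  show ?case
  proof (cases "u \<in> C")
    case True
    have "sum w (insert u P \<union> C) \<le> sum w C"
      using insert.hyps insert.prems(1) by (intro insert.prems(2) inward_closed_Un) auto
    moreover have "sum w (insert u P \<union> C) + sum w (insert u P \<inter> C) = sum w (insert u P) + sum w C"
      using insert.hyps insert.prems(1) by (intro sum.union_inter inward_closed_finite)
    ultimately have "sum w (insert u P \<inter> C) \<ge> 0"
      using insert.hyps by linarith
    then show ?thesis
      using mark_reachable.insert[OF IH, of u] True insert.hyps
        inward_closed_Int[OF insert.hyps(3) insert.prems(1)] by simp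
  qed (use IH in simp)
qed

lemma (in fin_digraph) mark_reachable_superset_insert:
  assumes X: "mark_reachable G w X" "M \<subseteq> X" and M: "inward_closed G M"
    and u: "inward_closed G (insert u M)" "sum w (insert u M) \<ge> 0"
  shows "\<exists>Y. mark_reachable G w Y \<and> insert u M \<subseteq> Y"
proof (cases "u \<in> M")
  case False
  let ?F = "{Z. inward_closed G Z \<and> M \<subseteq> Z \<and> Z \<subseteq> X}"
  have "finite X"
    using X mark_reachable_inward_closed inward_closed_finite by blast
  then have "finite ?F"
    by (auto intro: finite_subset[of _ "Pow X"])
  moreover have "M \<in> ?F"
    using X M by simp
  ultimately obtain C where C: "C \<in> ?F" and "sum w C = Max (sum w ` ?F)"
    using obtains_MAX[of ?F "sum w"] by (metis (no_types, lifting) empty_iff)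
  then have max: "sum w Z \<le> sum w C" if "Z \<in> ?F" for Z
    using that \<open>finite ?F\<close> by simp
  \<comment> \<open>As \<open>M \<subseteq> C \<subseteq> X\<close>, every closed set between
    \<open>C\<close> and \<open>C \<union> X = X\<close> belongs to \<open>?F\<close>, so
    \<open>max\<close> applies to it.\<close>
  have "mark_reachable G w (X \<inter> C)"
    using C by (intro mark_reachable_Int X(1) max) auto
  then have "mark_reachable G w C"
    using C by (simp add: Int_absorb1)
  show ?thesis
  proof (cases "u \<in> C")
    case True
    then show ?thesis using \<open>mark_reachable G w C\<close> C by blast
  next
    case False
    have "inward_closed G (insert u C)"
      using inward_closed_Un[OF u(1), of C] C by (simp add: Un_absorb1)
    \<comment> \<open>Since \<open>M\<close> itself competes in \<open>?F\<close>, w(C) + w(u) \<ge>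
      w(M) + w(u) \<ge> 0.\<close>
    moreover have "sum w (insert u C) \<ge> 0"
      using u(2) False \<open>u \<notin> M\<close> C M max[OF \<open>M \<in> ?F\<close>] by (simp add: inward_closed_finite)
    ultimately show ?thesis
      using mark_reachable.insert[OF \<open>mark_reachable G w C\<close> False] C by blast
  qed
qed (use X in \<open>auto simp: insert_absorb\<close>)

lemma source_inward_closed: "source G v \<Longrightarrow> inward_closed G {v}"
  by (auto simp: source_def inward_closed_def in_arcs_def arcs_ends_def arc_to_ends_def)

text \<open>An arc into \<open>v\<close> would have its tail in \<open>{v}\<close>, hence be a loop,
  which is a cycle. This makes the first marked vertex of a reachable set a source.\<close>

lemma (in dag) inward_closed_singleton_source:
  assumes "inward_closed G {v}"
  shows "source G v"
proof -
  have False if "e \<in> arcs G" "head G e = v" for e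
  proof -
    have "tail G e = v"
      using assms that by (auto simp: inward_closed_def arcs_ends_def arc_to_ends_def)
    then have "cycle [e]"
      using that by (auto simp: cycle_def awalk_def)
    then show False using no_cycle by blast
  qed
  then show ?thesis
    using assms by (auto simp: source_def inward_closed_def in_arcs_def)
qed

text \<open>The list records the nonempty sets of a derivation, one per marked vertex. Knowing that
  it ends in \<open>X\<close> allows the next marking to be appended.\<close>

lemma (in dag) mark_reachable_sequence:
  assumes "mark_reachable G w X" "X \<noteq> {}"
  shows "\<exists>Ms. Ms \<noteq> [] \<and> length Ms = card X \<and> last Ms = X \<and> (\<exists>v. source G v \<and> Ms ! 0 = {v}) \<and>
    (\<forall>i. Suc i < length Ms \<longrightarrow> marking G (Ms ! i) (Ms ! Suc i)) \<and> nonneg_sequence w Ms"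
  using assms
proof (induction rule: mark_reachable.induct)
  case (insert X u)
  show ?case
  proof (cases "X = {}")
    case True
    then show ?thesis
      using insert.hyps inward_closed_singleton_source
      by (intro exI[of _ "[{u}]"]) (auto simp: nonneg_sequence_def)
  next
    case False
    then obtain Ms where Ms: "Ms \<noteq> []" "length Ms = card X" "last Ms = X"
      "\<exists>v. source G v \<and> Ms ! 0 = {v}" "nonneg_sequence w Ms"
      "\<And>i. Suc i < length Ms \<Longrightarrow> marking G (Ms ! i) (Ms ! Suc i)"
      using insert.IH by blast
    let ?Ns = "Ms @ [insert u X]"
    have "finite X"
      using insert.hyps mark_reachable_inward_closed inward_closed_finite by blast
    have "marking G (?Ns ! i) (?Ns ! Suc i)" if "Suc i < length ?Ns" for i
    proof (cases "Suc i < length Ms")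
      case True
      then show ?thesis using Ms(6) by (simp add: nth_append)
    next
      case False
      \<comment> \<open>The only new transition is the one from the old last set \<open>X\<close> to
        the appended set.\<close>
      then have "Suc i = length Ms" using that by simp
      then have "?Ns ! i = X" "?Ns ! Suc i = insert u X"
        using Ms(1,3) by (auto simp: nth_append last_conv_nth simp flip: \<open>Suc i = length Ms\<close>)
      then show ?thesis
        using insert.hyps by (auto simp: marking_def)
    qed
    then show ?thesis
      using Ms insert.hyps \<open>finite X\<close>
      by (intro exI[of _ ?Ns]) (auto simp: nth_append nonneg_sequence_def)
  qed
qed simp

theorem theorem1:
  fixes G :: "('a, 'b) pre_digraph" and w :: "'a \<Rightarrow> real"
  assumes "dag G"
    and "\<exists>Ms. mark_unmark_sequence G Ms \<and> nonneg_sequence w Ms"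
  shows "\<exists>Ms. mark_sequence G Ms \<and> nonneg_sequence w Ms"
proof -
  interpret dag G by fact
  obtain Ms v where ne: "Ms \<noteq> []" and v: "source G v" "Ms ! 0 = {v}"
    and step: "\<And>i. Suc i < length Ms \<Longrightarrow>
      marking G (Ms ! i) (Ms ! Suc i) \<or> unmarking G (Ms ! i) (Ms ! Suc i)"
    and last: "last Ms = verts G" and nonneg: "nonneg_sequence w Ms"
    using assms(2) unfolding mark_unmark_sequence_def by blast
  have w: "sum w (Ms ! i) \<ge> 0" if "i < length Ms" for i
    using nonneg that by (simp add: nonneg_sequence_def)
  \<comment> \<open>Closedness is carried along because it makes \<open>Ms ! i\<close> a candidate
    for \<open>C\<close> at the next marking. The sets \<open>X\<close> for different
    \<open>i\<close> need not be nested.\<close>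
  have "inward_closed G (Ms ! i) \<and> (\<exists>X. mark_reachable G w X \<and> Ms ! i \<subseteq> X)"
    if "i < length Ms" for i
    using that
  proof (induction i)
    case 0
    have "inward_closed G {v}"
      by (rule source_inward_closed[OF v(1)])
    then have "mark_reachable G w {v}"
      using mark_reachable.insert[OF mark_reachable.empty, of v G w] w[OF 0] v by simp
    then show ?case
      using v \<open>inward_closed G {v}\<close> by auto
  next
    case (Suc i)
    then obtain X where X: "mark_reachable G w X" "Ms ! i \<subseteq> X" and closed: "inward_closed G (Ms ! i)"
      by auto
    from step[OF Suc.prems] show ?case
    proof
      assume "marking G (Ms ! i) (Ms ! Suc i)"
      then obtain u where "Ms ! Suc i = insert u (Ms ! i)" "inward_closed G (insert u (Ms ! i))"
        by (auto simp: marking_def)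
      then show ?thesis
        using mark_reachable_superset_insert[OF X closed] w[OF Suc.prems] by simp
    next
      assume "unmarking G (Ms ! i) (Ms ! Suc i)"
      then show ?thesis
        using X by (auto simp: unmarking_def)
    qed
  qed
  from this[of "length Ms - 1"] obtain X where X: "mark_reachable G w X" "verts G \<subseteq> X"
    using ne last by (auto simp: last_conv_nth)
  \<comment> \<open>Reachable sets are inward closed and so lie inside
    \<open>verts G\<close>.\<close>
  then have "X = verts G"
    using mark_reachable_inward_closed[OF X(1)] by (simp add: inward_closed_def)
  moreover have "verts G \<noteq> {}"
    using v by (auto simp: source_def)
  ultimately show ?thesis
    using mark_reachable_sequence[OF X(1)] unfolding mark_sequence_def by metis
qed

end
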